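(* Let $f(z)=z+\sum_{n\ge 2}a_nz^n$ belong to $\mathcal{S}^*_B$. Then $$|a_2|\le 1,\qquad |a_3|\le \frac34,\qquad |a_4|\le\frac{19}{36},\qquad |a_5|\le \frac{101}{288}.$$ These inequalities are sharp, i.e. for each of them there is a function in $\mathcal{S}^*_B$ for which equality holds.
   Context: Let $\mathbb{D}=\{z\in\mathbb{C}:|z|<1\}$ and let $\mathcal{A}$ be the class of analytic functions $f$ on $\mathbb{D}$ with $f(0)=0$, $f'(0)=1$, written $f(z)=z+\sum_{n=2}^\infty a_nz^n$. For analytic functions $g,h$ on $\mathbb{D}$, $g\prec h$ ($g$ is subordinate to $h$) means $g(z)=h(w(z))$ on $\mathbb{D}$ for some analytic $w:\mathbb{D}\to\mathbb{D}$ with $w(0)=0$. Let $B(z)=\dfrac{1}{1-\log(1+z)}$ on $\mathbb{D}$ (principal branch of the logarithm), and let $$\mathcal{S}^*_B=\left\{f\in\mathcal{A}:\ \frac{zf'(z)}{f(z)}\prec B(z)\right\}.$$ *)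

theory Defs
  imports "HOL-Complex_Analysis.Complex_Analysis"
begin

abbreviation unit_disc :: "complex set"  ("\<D>")
  where "\<D> \<equiv> ball 0 1"

(* Functions on the disc are total functions of type complex => complex; only their
   values on the disc matter (it is open, so this includes deriv f z for z in it). *)
definition normalized_analytic :: "(complex \<Rightarrow> complex) set"  ("\<A>")
  where "\<A> = {f. f holomorphic_on \<D> \<and> f 0 = 0 \<and> deriv f 0 = 1}"

definition subordinate :: "(complex \<Rightarrow> complex) \<Rightarrow> (complex \<Rightarrow> complex) \<Rightarrow> bool"  (infix "\<prec>\<^sub>s" 50)
  where "g \<prec>\<^sub>s h \<longleftrightarrow>
    g holomorphic_on \<D> \<and> h holomorphic_on \<D> \<and>
    (\<exists>w. w holomorphic_on \<D> \<and> w ` \<D> \<subseteq> \<D> \<and> w 0 = 0 \<and> (\<forall>z\<in>\<D>. g z = h (w z)))"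

(* Ln is the principal branch. *)
definition B_fun :: "complex \<Rightarrow> complex"
  where "B_fun z = 1 / (1 - Ln (1 + z))"

(* The quotient z f'(z) / f(z) has a removable singularity at 0 with value 1 for f in A.
   A zero of f elsewhere in the disc would make the HOL quotient 0 there (x / 0 = 0);
   such f are not in the class below, since B_fun has no zero on the disc. *)
definition starlike_quotient :: "(complex \<Rightarrow> complex) \<Rightarrow> complex \<Rightarrow> complex"
  where "starlike_quotient f z = (if z = 0 then 1 else z * deriv f z / f z)"

definition starlike_B :: "(complex \<Rightarrow> complex) set"  ("\<S>\<^sub>B")
  where "\<S>\<^sub>B = {f \<in> \<A>. starlike_quotient f \<prec>\<^sub>s B_fun}"

abbreviation taylor_coeff :: "(complex \<Rightarrow> complex) \<Rightarrow> nat \<Rightarrow> complex"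
  where "taylor_coeff f n \<equiv> fps_nth (fps_expansion f 0) n"

end

(* With w the Schwarz function of f, the function p = (1 + w) / (1 - w) = 1 + p_1 z + ... has
   positive real part, so |p_n| <= 2 and (Schwarz-Pick) |p_2 - p_1^2 / 2| <= 2 - |p_1|^2 / 2.
   Written in the p_n, the coefficients a_2, a_3, a_4 have nonnegative weights and are maximal when
   all p_n = 2.  In 4 a_5 = p_4 / 2 + p_1 p_3 / 12 + p_1^2 p_2 / 48 - 7 p_1^4 / 1152 one weight is
   negative; grouping it as p_1^2 (p_2 - p_1^2 / 2) / 48 + 5 p_1^4 / 1152 leaves a polynomial in
   |p_1| that is largest at |p_1| = 2.  The choice w(z) = z gives p_n = 2 for all n and hence
   equality in all four inequalities. *)
theory Submission
  imports Defs
begin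

unbundle no vec_syntax

section \<open>Coefficient estimates and power series on the unit disc\<close>

lemma taylor_coeff_bounded:
  assumes "f holomorphic_on \<D>" and "\<And>z. z \<in> \<D> \<Longrightarrow> norm (f z) \<le> 1"
  shows "norm (taylor_coeff f n) \<le> 1"
proof -
  have *: "norm (taylor_coeff f n) * r ^ n \<le> 1" if r: "0 < r" "r < 1" for r :: real
  proof -
    have sub: "cball 0 r \<subseteq> \<D>" "ball 0 r \<subseteq> \<D>" using r by auto
    have "norm ((deriv ^^ n) f 0) \<le> fact n * 1 / r ^ n"
      using r sub assms
      by (intro Cauchy_inequality)
        (auto intro: holomorphic_on_subset holomorphic_on_imp_continuous_on)
    then show ?thesis
      using r by (simp add: fps_expansion_def norm_divide field_simps)
  qed
  \<comment> \<open>Nothing is assumed about \<open>f\<close> on the unit circle, so the Cauchy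
    estimate is taken on smaller circles and the radius tends to 1.\<close>
  have "((\<lambda>r. norm (taylor_coeff f n) * r ^ n) \<longlongrightarrow> norm (taylor_coeff f n) * 1 ^ n) (at_left 1)"
    by (intro tendsto_intros)
  moreover have "\<forall>\<^sub>F r in at_left 1. norm (taylor_coeff f n) * r ^ n \<le> (1::real)"
    using eventually_at_left_real[OF zero_less_one] by eventually_elim (use * in auto)
  ultimately show ?thesis
    by (auto dest: tendsto_upperbound)
qed

lemma holomorphic_disc_has_fps_expansion:
  "f holomorphic_on \<D> \<Longrightarrow> f has_fps_expansion fps_expansion f 0"
  by (rule has_fps_expansion_fps_expansion[of \<D>]) auto

text \<open>Passes from a pointwise identity on the disc to an identity of formal power series;
  every functional equation below reaches the coefficients in this way.\<close>

lemma has_fps_expansion_disc_eq: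
  assumes "f has_fps_expansion F" "g has_fps_expansion G" "\<And>z. z \<in> \<D> \<Longrightarrow> f z = g z"
  shows "F = (G :: complex fps)"
proof -
  have "\<forall>\<^sub>F z in nhds 0. f z = g z"
    using assms(3) by (intro eventually_nhds_in_open[THEN eventually_mono, of \<D>]) auto
  then have "g has_fps_expansion F" using assms(1) has_fps_expansion_cong by blast
  then show ?thesis using assms(2) fps_expansion_unique_complex by blast
qed

section \<open>Caratheodory's coefficient bound for functions of positive real part\<close>

lemma norm_cayley_less_1:
  assumes "Re z > 0" shows "norm ((z - 1) / (z + 1)) < 1"
proof -
  \<comment> \<open>The difference of the two squares is 4 Re z.\<close>
  have "(norm (z - 1))\<^sup>2 < (norm (z + 1))\<^sup>2"
    using assms unfolding cmod_power2 by (simp add: power2_eq_square algebra_simps)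
  then have "norm (z - 1) < norm (z + 1)" by (rule power2_less_imp_less) simp
  then show ?thesis by (smt (verit) divide_less_eq_1 norm_divide norm_ge_zero)
qed

text \<open>The summands are the powers of exp (2 pi i m / n). This is an n-th root of unity,
  different from 1 because n does not divide m, so the geometric sum vanishes.\<close>

lemma sum_root_unity_powers:
  assumes "0 < m" "m < n"
  shows "(\<Sum>k<n. (exp (2 * of_real pi * \<i> / of_nat n) ^ k) ^ m) = (0::complex)"
proof -
  define z where "z = exp (2 * of_real pi * \<i> * of_nat m / of_nat n)"
  have "z ^ n = 1"
    using assms unfolding z_def by (subst exp_of_nat_mult[symmetric])
      (simp add: exp_eq_1, rule exI[of _ "int m"], simp)
  moreover have "z \<noteq> 1"
    using complex_root_unity_eq[of n m 0] assms by (simp add: z_def cong_def)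
  moreover have "(exp (2 * of_real pi * \<i> / of_nat n) ^ k) ^ m = z ^ k" for k
    by (simp add: z_def flip: exp_of_nat_mult) (simp add: algebra_simps)
  ultimately show ?thesis
    by (simp add: sum_gp_strict)
qed

text \<open>Averaging \<open>p\<close> over the rotations by \<open>n\<close>-th roots of unity keeps the real part positive and kills
  the coefficients of order \<open>1, \<dots>, n - 1\<close>; the Cayley transform then turns the claim into the
  Cauchy estimate for a function bounded by 1.\<close>

lemma caratheodory_coeff_bound:
  assumes p: "p holomorphic_on \<D>" "\<And>z. z \<in> \<D> \<Longrightarrow> Re (p z) > 0" "p 0 = 1" and "n > 0"
  shows "norm (taylor_coeff p n) \<le> 2"
proof -
  define P where "P = fps_expansion p 0"
  define c :: "nat \<Rightarrow> complex" where "c k = exp (2 * of_real pi * \<i> / of_nat n) ^ k" for k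
  have nc: "norm (c k) = 1" for k by (simp add: c_def norm_power)
  define q where "q z = (\<Sum>k<n. p (c k * z)) / of_nat n" for z
  define Q where "Q = fps_const (1 / of_nat n) * (\<Sum>k<n. P oo (fps_const (c k) * fps_X))"
  have img: "(\<lambda>z. c k * z) ` \<D> \<subseteq> \<D>" for k using nc by (auto simp: norm_mult)
  have pe: "p has_fps_expansion P"
    unfolding P_def by (rule holomorphic_disc_has_fps_expansion) fact
  have qhol: "q holomorphic_on \<D>"
  proof -
    have "(\<lambda>z. p (c k * z)) holomorphic_on \<D>" for k
      using holomorphic_on_compose_gen[OF _ p(1) img[of k]]
      by (auto simp: o_def intro!: holomorphic_intros)
    then show ?thesis unfolding q_def by (intro holomorphic_intros) (use \<open>n > 0\<close> in auto)
  qed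
  have "(\<lambda>z. (1 / of_nat n) * (\<Sum>k<n. (p \<circ> (\<lambda>z. c k * z)) z)) has_fps_expansion Q"
    unfolding Q_def by (intro fps_expansion_intros pe) auto
  then have qe: "q has_fps_expansion Q"
    by (simp add: q_def[abs_def] o_def)
  have Qnth: "Q $ m = P $ m * (\<Sum>k<n. c k ^ m) / of_nat n" for m
    by (simp add: Q_def fps_compose_linear fps_sum_nth sum_distrib_left[symmetric] del: fps_const_mult_apply_left)
      (simp add: sum_distrib_left mult.commute)
  have P0: "P $ 0 = 1" using p(3) by (simp add: P_def fps_expansion_def)
  have Q0: "Q $ 0 = 1" using \<open>n > 0\<close> by (simp add: Qnth P0)
  have Qm: "Q $ m = 0" if "0 < m" "m < n" for m
    using sum_root_unity_powers[OF that] by (simp add: Qnth c_def)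
  have "c k ^ n = 1" for k
  proof -
    have "c k ^ n = (exp (2 * of_real pi * \<i> / of_nat n) ^ n) ^ k"
      unfolding c_def by (simp add: power_mult[symmetric] mult.commute)
    also have "exp (2 * complex_of_real pi * \<i> / of_nat n) ^ n = 1"
      using \<open>n > 0\<close> by (simp flip: exp_of_nat_mult)
    finally show ?thesis by simp
  qed
  then have Qn: "Q $ n = P $ n" using \<open>n > 0\<close> by (simp add: Qnth)
  have qpos: "Re (q z) > 0" if "z \<in> \<D>" for z
  proof -
    have "(\<Sum>k<n. Re (p (c k * z))) > 0"
      using \<open>n > 0\<close> that nc by (intro sum_pos p(2)) (auto simp: norm_mult)
    then show ?thesis using \<open>n > 0\<close> by (simp add: q_def)
  qed
  define w where "w z = (q z - 1) / (q z + 1)" for z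
  have nz: "q z + 1 \<noteq> 0" if "z \<in> \<D>" for z
    using qpos[OF that] by (auto simp: complex_eq_iff)
  have whol: "w holomorphic_on \<D>"
    unfolding w_def by (intro holomorphic_intros qhol) (use nz in auto)
  define W where "W = fps_expansion w 0"
  have "norm (W $ n) \<le> 1"
    unfolding W_def using whol norm_cayley_less_1 qpos
    by (intro taylor_coeff_bounded) (auto simp: w_def less_imp_le)
  moreover have "W $ n = P $ n / 2"
  proof -
    have "W * (Q + 1) = Q - 1"
    proof (rule has_fps_expansion_disc_eq)
      show "(\<lambda>z. w z * (q z + 1)) has_fps_expansion W * (Q + 1)"
        unfolding W_def by (intro fps_expansion_intros qe holomorphic_disc_has_fps_expansion whol)
      show "(\<lambda>z. q z - 1) has_fps_expansion Q - 1"
        by (intro fps_expansion_intros qe)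
    qed (use nz in \<open>auto simp: w_def\<close>)
    moreover have "(Q + 1) $ 0 \<noteq> 0" using Q0 by simp
    ultimately have "W = (Q - 1) * inverse (Q + 1)"
      by (metis inverse_mult_eq_1' mult.assoc mult.right_neutral)
    then have "W $ n = (\<Sum>i=0..n. (Q - 1) $ i * inverse (Q + 1) $ (n - i))"
      by (simp add: fps_mult_nth)
    \<comment> \<open>All coefficients of \<open>Q - 1\<close> below order n vanish, so only i = n
      survives; the constant term of \<open>inverse (Q + 1)\<close> is 1/2 because \<open>Q\<close>
      starts with 1.\<close>
    also have "\<dots> = (\<Sum>i=0..n. if i = n then (Q - 1) $ n * inverse (Q + 1) $ 0 else 0)"
      using Q0 Qm by (intro sum.cong) (auto simp: gr0_conv_Suc)
    also have "\<dots> = P $ n / 2"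
      using \<open>n > 0\<close> Q0 Qn by simp
    finally show ?thesis .
  qed
  ultimately show ?thesis by (simp add: P_def norm_divide)
qed

section \<open>Schwarz-Pick and the second coefficient of a Schwarz function\<close>

text \<open>Following \<open>f\<close> by the disc automorphism that moves a = f(0) to 0 gives a map
  to which the Schwarz lemma applies. By the chain rule its derivative at 0 is f'(0) / (1 -
  |a|^2).\<close>

lemma schwarz_pick_0:
  assumes f: "f holomorphic_on \<D>" "f ` \<D> \<subseteq> \<D>"
  shows "norm (deriv f 0) \<le> 1 - (norm (f 0))\<^sup>2"
proof -
  define a where "a = f 0"
  have a: "norm a < 1" using f(2) by (auto simp: a_def image_subset_iff)
  define g where "g = Moebius_function 0 a \<circ> f"
  have "g holomorphic_on \<D>"
    unfolding g_def using f Moebius_function_holomorphic[OF a] by (intro holomorphic_on_compose_gen)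
  moreover have "g 0 = 0" by (simp add: g_def a_def Moebius_function_eq_zero)
  moreover have "norm (g z) < 1" if "norm z < 1" for z
    using Moebius_function_norm_lt_1[OF a, of "f z" 0] f(2) that by (auto simp: g_def image_subset_iff)
  ultimately have "norm (deriv g 0) \<le> 1"
    by (rule Schwarz_Lemma(2)[of g 0]) auto
  moreover have "deriv g 0 = deriv f 0 / (1 - cnj a * a)"
  proof (rule DERIV_imp_deriv)
    have ne: "1 - cnj a * f 0 \<noteq> 0"
    proof -
      have "norm a * norm a < 1" using a mult_strict_mono[of "norm a" 1 "norm a" 1] by auto
      then have "norm (cnj a * f 0) < 1" by (simp add: norm_mult a_def)
      then show ?thesis by auto
    qed
    have d: "(f has_field_derivative deriv f 0) (at 0)"
      using f(1) by (intro holomorphic_derivI[of _ \<D>]) auto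
    have "((\<lambda>z. (f z - a) / (1 - cnj a * f z)) has_field_derivative
        (deriv f 0 * (1 - cnj a * f 0) - (f 0 - a) * - (cnj a * deriv f 0)) /
        ((1 - cnj a * f 0) * (1 - cnj a * f 0))) (at 0)"
      using ne by (auto intro!: derivative_eq_intros d)
    then show "(g has_field_derivative deriv f 0 / (1 - cnj a * a)) (at 0)"
      using ne by (simp add: g_def o_def Moebius_function_simple a_def)
  qed
  moreover have "1 - cnj a * a = of_real (1 - (norm a)\<^sup>2)"
    by (simp add: mult.commute flip: complex_norm_square)
  moreover have "(norm a)\<^sup>2 < 1" using a by (simp add: power_less_one_iff)
  ultimately show ?thesis
    by (simp add: norm_divide a_def del: of_real_diff)
qed

text \<open>Write w(z) = z h(z), so that h(0) and h'(0) are the first two coefficients of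
  \<open>w\<close>, and apply Schwarz-Pick to \<open>h\<close>. A rotation is treated separately:
  there \<open>h\<close> is a constant of modulus 1 and leaves the open disc, while both sides of
  the claim are 0.\<close>

lemma schwarz_second_coeff:
  assumes w: "w holomorphic_on \<D>" "w ` \<D> \<subseteq> \<D>" "w 0 = 0"
  shows "norm (taylor_coeff w 2) \<le> 1 - (norm (taylor_coeff w 1))\<^sup>2"
proof (cases "\<exists>\<alpha>. (\<forall>z. norm z < 1 \<longrightarrow> w z = \<alpha> * z) \<and> norm \<alpha> = 1")
  case True
  then obtain \<alpha> where \<alpha>: "\<And>z. norm z < 1 \<Longrightarrow> w z = \<alpha> * z" "norm \<alpha> = 1" by blast
  have "fps_expansion w 0 = fps_const \<alpha> * fps_X"
    by (rule has_fps_expansion_disc_eq[of w _ "\<lambda>z. \<alpha> * z"])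
      (auto intro!: holomorphic_disc_has_fps_expansion w fps_expansion_intros simp: \<alpha>)
  then show ?thesis using \<alpha>(2) by simp
next
  case False
  have w1: "norm (w z) < 1" if "norm z < 1" for z using w(2) that by (auto simp: image_subset_iff)
  note S = Schwarz_Lemma[OF w(1,3) w1]
  obtain h where h: "h holomorphic_on \<D>" "\<And>z. norm z < 1 \<Longrightarrow> w z = z * h z" "deriv w 0 = h 0"
    using Schwarz3[OF w(1,3)] by blast
  \<comment> \<open>Equality in the Schwarz lemma, for the derivative at the origin or for the value
    at another point, would make \<open>w\<close> a rotation, which this case excludes.\<close>
  have "norm (h z) < 1" if "norm z < 1" for z
  proof (cases "z = 0")
    case True
    then show ?thesis using S(2)[of 0] S(3)[of 0] False h(3) by fastforce
  next
    case z: False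
    have "norm (w z) < norm z"
      using S(1)[OF _ that] S(3)[OF _ that] False z that by fastforce
    then show ?thesis using h(2)[OF that] z by (simp add: norm_mult)
  qed
  then have "norm (deriv h 0) \<le> 1 - (norm (h 0))\<^sup>2"
    by (intro schwarz_pick_0 h) auto
  moreover have "fps_expansion w 0 = fps_X * fps_expansion h 0"
    by (rule has_fps_expansion_disc_eq[of w _ "\<lambda>z. z * h z"])
      (auto intro!: holomorphic_disc_has_fps_expansion w h(1) fps_expansion_intros simp: h(2))
  ultimately show ?thesis
    by (simp add: fps_expansion_def numeral_2_eq_2)
qed

section \<open>Algebra: the quartic estimate and the coefficient formulas\<close>

text \<open>The left side is the bound for 4 |a_5| as a function of y = |p_1|. Equality holds at y =
  2, so 2 - y splits off from the difference; the cofactor is at least 232 - 36 y, which is positive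
  on the interval.\<close>

lemma real_quartic_bound:
  fixes y :: real assumes "0 \<le> y" "y \<le> 2"
  shows "1 + y / 6 + y\<^sup>2 / 48 * (2 - y\<^sup>2 / 2) + 5 / 1152 * y ^ 4 \<le> 101 / 72"
proof -
  have "101 / 72 - (1 + y / 6 + y\<^sup>2 / 48 * (2 - y\<^sup>2 / 2) + 5 / 1152 * y ^ 4)
      = (2 - y) * (232 + 20 * y - 14 * y\<^sup>2 - 7 * y ^ 3) / 1152"
    by (simp add: field_simps power2_eq_square power3_eq_cube power4_eq_xxxx)
  moreover have "y\<^sup>2 \<le> 2 * y" "y ^ 3 \<le> 2 * y\<^sup>2"
    using assms mult_right_mono[of y 2 y] mult_right_mono[of y 2 "y\<^sup>2"]
    by (auto simp: power2_eq_square power3_eq_cube)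
  then have "232 + 20 * y - 14 * y\<^sup>2 - 7 * y ^ 3 \<ge> 0" using assms by linarith
  ultimately show ?thesis using assms
    by (smt (verit) divide_nonneg_pos mult_nonneg_nonneg)
qed

text \<open>The first index is written \<open>Suc 0\<close>, the form to which the simplifier brings
  \<open>1\<close>.\<close>

lemma fps_mult_nth_small:
  fixes f g :: "complex fps"
  shows "(f * g) $ Suc 0 = f $ 0 * g $ 1 + f $ 1 * g $ 0"
    "(f * g) $ 2 = f $ 0 * g $ 2 + f $ 1 * g $ 1 + f $ 2 * g $ 0"
    "(f * g) $ 3 = f $ 0 * g $ 3 + f $ 1 * g $ 2 + f $ 2 * g $ 1 + f $ 3 * g $ 0"
    "(f * g) $ 4 = f $ 0 * g $ 4 + f $ 1 * g $ 3 + f $ 2 * g $ 2 + f $ 3 * g $ 1 + f $ 4 * g $ 0"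
    "(f * g) $ 5 = f $ 0 * g $ 5 + f $ 1 * g $ 4 + f $ 2 * g $ 3 + f $ 3 * g $ 2 + f $ 4 * g $ 1 + f $ 5 * g $ 0"
  by (simp_all add: fps_mult_nth numeral_eq_Suc)

text \<open>The logarithm enters through its differential equation, so that no composition of power series
  has to be expanded: \<open>L\<close> is the series of \<open>log (1 + w)\<close> and \<open>Q\<close> that of \<open>z f' / f\<close>.\<close>

lemma fps_coeffs_starlike_B:
  fixes F Q L W P :: "complex fps"
  assumes "fps_X * fps_deriv F = F * Q" "Q * (1 - L) = 1" "fps_deriv L * (1 + W) = fps_deriv W"
    "P * (1 - W) = 1 + W" and 0: "F $ 0 = 0" "F $ 1 = 1" "L $ 0 = 0" "W $ 0 = 0"
  shows "F $ 2 = P $ 1 / 2"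
    and "F $ 3 = P $ 2 / 4 + (P $ 1) ^ 2 / 16"
    and "F $ 4 = P $ 3 / 6 + P $ 1 * P $ 2 / 24 + (P $ 1) ^ 3 / 288"
    and "F $ 5 = P $ 4 / 8 + P $ 1 * P $ 3 / 48
      + (P $ 1) ^ 2 / 192 * (P $ 2 - (P $ 1) ^ 2 / 2) + 5 / 4608 * (P $ 1) ^ 4"
    and "W $ 1 = P $ 1 / 2" and "W $ 2 = P $ 2 / 2 - (P $ 1) ^ 2 / 4"
proof -
  have eq1: "(fps_X * fps_deriv F) $ n = (F * Q) $ n" and eq2: "(Q * (1 - L)) $ n = 1 $ n"
    and eq3: "(fps_deriv L * (1 + W)) $ n = fps_deriv W $ n" and eq4: "(P * (1 - W)) $ n = (1 + W) $ n" for n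
    using assms(1-4) by simp_all
  \<comment> \<open>The system is triangular: \<open>eq4\<close> gives \<open>W\<close> from
    \<open>P\<close>, \<open>eq3\<close> gives \<open>L\<close> from \<open>W\<close>,
    \<open>eq2\<close> gives \<open>Q\<close> from \<open>L\<close>, and \<open>eq1\<close> gives
    \<open>F\<close> from \<open>Q\<close>.\<close>
  have P0: "P $ 0 = 1" using eq4[of 0] 0 by simp
  have Q0: "Q $ 0 = 1" using eq2[of 0] 0 by simp
  have W1: "W $ 1 = P $ 1 / 2" using eq4[of 1] P0 0
    by (simp add: fps_mult_nth_small field_simps)
  have "W $ 2 = (P $ 2 - P $ 1 * W $ 1) / 2"
    using eq4[of 2] P0 0 by (simp add: fps_mult_nth_small algebra_simps)
  also have "\<dots> = P $ 2 / 2 - (P $ 1) ^ 2 / 4"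
    unfolding W1 by (simp add: field_simps power2_eq_square power3_eq_cube power4_eq_xxxx)
  finally have W2: "W $ 2 = P $ 2 / 2 - (P $ 1) ^ 2 / 4" .
  have "W $ 3 = (P $ 3 - P $ 1 * W $ 2 - P $ 2 * W $ 1) / 2"
    using eq4[of 3] P0 0 by (simp add: fps_mult_nth_small algebra_simps)
  also have "\<dots> = P $ 3 / 2 - P $ 1 * P $ 2 / 2 + (P $ 1) ^ 3 / 8"
    unfolding W2 W1 by (simp add: field_simps power2_eq_square power3_eq_cube power4_eq_xxxx)
  finally have W3: "W $ 3 = P $ 3 / 2 - P $ 1 * P $ 2 / 2 + (P $ 1) ^ 3 / 8" .
  have "W $ 4 = (P $ 4 - P $ 1 * W $ 3 - P $ 2 * W $ 2 - P $ 3 * W $ 1) / 2"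
    using eq4[of 4] P0 0 by (simp add: fps_mult_nth_small algebra_simps)
  also have "\<dots> = P $ 4 / 2 - P $ 1 * P $ 3 / 2 - (P $ 2) ^ 2 / 4 + 3 / 8 * (P $ 1) ^ 2 * P $ 2 - (P $ 1) ^ 4 / 16"
    unfolding W3 W2 W1 by (simp add: field_simps power2_eq_square power3_eq_cube power4_eq_xxxx)
  finally have W4: "W $ 4 = P $ 4 / 2 - P $ 1 * P $ 3 / 2 - (P $ 2) ^ 2 / 4 + 3 / 8 * (P $ 1) ^ 2 * P $ 2 - (P $ 1) ^ 4 / 16" .
  \<comment> \<open>Differentiation shifts the index: order k of \<open>eq3\<close> determines the
    coefficient of order k + 1 of \<open>L\<close>, with factor k + 1.\<close>
  have L1: "L $ 1 = W $ 1" using eq3[of 0] 0 by simp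
  have "L $ 2 = (2 * W $ 2 - L $ 1 * W $ 1) / 2"
    using eq3[of 1] 0 by (simp add: fps_mult_nth_small algebra_simps flip: numeral_2_eq_2 numeral_3_eq_3)
  also have "\<dots> = W $ 2 - (W $ 1) ^ 2 / 2"
    unfolding L1 by (simp add: field_simps power2_eq_square power3_eq_cube power4_eq_xxxx)
  finally have L2: "L $ 2 = W $ 2 - (W $ 1) ^ 2 / 2" .
  have "L $ 3 = (3 * W $ 3 - 2 * L $ 2 * W $ 1 - L $ 1 * W $ 2) / 3"
    using eq3[of 2] 0 by (simp add: fps_mult_nth_small algebra_simps flip: numeral_2_eq_2 numeral_3_eq_3)
  also have "\<dots> = W $ 3 - W $ 1 * W $ 2 + (W $ 1) ^ 3 / 3"
    unfolding L2 L1 by (simp add: field_simps power2_eq_square power3_eq_cube power4_eq_xxxx)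
  finally have L3: "L $ 3 = W $ 3 - W $ 1 * W $ 2 + (W $ 1) ^ 3 / 3" .
  have "L $ 4 = (4 * W $ 4 - 3 * L $ 3 * W $ 1 - 2 * L $ 2 * W $ 2 - L $ 1 * W $ 3) / 4"
    using eq3[of 3] 0 by (simp add: fps_mult_nth_small algebra_simps flip: numeral_2_eq_2 numeral_3_eq_3)
  also have "\<dots> = W $ 4 - W $ 1 * W $ 3 - (W $ 2) ^ 2 / 2 + (W $ 1) ^ 2 * W $ 2 - (W $ 1) ^ 4 / 4"
    unfolding L3 L2 L1 by (simp add: field_simps power2_eq_square power3_eq_cube power4_eq_xxxx)
  finally have L4: "L $ 4 = W $ 4 - W $ 1 * W $ 3 - (W $ 2) ^ 2 / 2 + (W $ 1) ^ 2 * W $ 2 - (W $ 1) ^ 4 / 4" .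
  have Q1: "Q $ 1 = L $ 1" using eq2[of 1] Q0 0
    by (simp add: fps_mult_nth_small)
  have Q2: "Q $ 2 = L $ 2 + L $ 1 * Q $ 1" using eq2[of 2] Q0 0
    by (simp add: fps_mult_nth_small algebra_simps)
  have Q3: "Q $ 3 = L $ 3 + L $ 2 * Q $ 1 + L $ 1 * Q $ 2" using eq2[of 3] Q0 0
    by (simp add: fps_mult_nth_small algebra_simps)
  have Q4: "Q $ 4 = L $ 4 + L $ 3 * Q $ 1 + L $ 2 * Q $ 2 + L $ 1 * Q $ 3"
    using eq2[of 4] Q0 0
    by (simp add: fps_mult_nth_small algebra_simps)
  \<comment> \<open>Order n of \<open>eq1\<close> has n times \<open>F $ n\<close> on the left and,
    since \<open>Q $ 0 = 1\<close>, one more copy of it on the right; hence the divisor n -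
    1.\<close>
  have F2: "F $ 2 = Q $ 1" using eq1[of 2] Q0 0
    by (simp add: fps_mult_nth_small numeral_2_eq_2[symmetric])
  have F3: "F $ 3 = (Q $ 2 + F $ 2 * Q $ 1) / 2" using eq1[of 3] Q0 0
    by (simp add: fps_mult_nth_small algebra_simps flip: numeral_2_eq_2 numeral_3_eq_3)
  have F4: "F $ 4 = (Q $ 3 + F $ 2 * Q $ 2 + F $ 3 * Q $ 1) / 3" using eq1[of 4] Q0 0
    by (simp add: fps_mult_nth_small algebra_simps flip: numeral_2_eq_2 numeral_3_eq_3)
  have F5: "F $ 5 = (Q $ 4 + F $ 2 * Q $ 3 + F $ 3 * Q $ 2 + F $ 4 * Q $ 1) / 4"
    using eq1[of 5] Q0 0
    by (simp add: fps_mult_nth_small algebra_simps flip: numeral_2_eq_2 numeral_3_eq_3)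
  show A2: "F $ 2 = P $ 1 / 2" using F2 Q1 L1 W1 by simp
  have q2: "Q $ 2 = P $ 2 / 2 - (P $ 1) ^ 2 / 8" unfolding Q2 Q1 L2 L1 W2 W1 by (simp add: field_simps power2_eq_square)
  show A3: "F $ 3 = P $ 2 / 4 + (P $ 1) ^ 2 / 16" 
    unfolding F3 A2 q2 Q1 L1 W1 by (simp add: field_simps power2_eq_square)
  have q3: "Q $ 3 = P $ 3 / 2 - P $ 1 * P $ 2 / 4 + (P $ 1) ^ 3 / 24"
    unfolding Q3 q2 Q1 L3 L2 L1 W3 W2 W1 by (simp add: field_simps power2_eq_square power3_eq_cube)
  show A4: "F $ 4 = P $ 3 / 6 + P $ 1 * P $ 2 / 24 + (P $ 1) ^ 3 / 288"
    unfolding F4 A3 A2 q3 q2 Q1 L1 W1 by (simp add: field_simps power2_eq_square power3_eq_cube)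
  show A5: "F $ 5 = P $ 4 / 8 + P $ 1 * P $ 3 / 48
      + (P $ 1) ^ 2 / 192 * (P $ 2 - (P $ 1) ^ 2 / 2) + 5 / 4608 * (P $ 1) ^ 4"
    unfolding F5 A4 A3 A2 q3 q2 Q4 Q1 L4 L3 L2 L1 W4 W3 W2 W1 
    by (simp add: field_simps power2_eq_square power3_eq_cube power4_eq_xxxx)
  show "W $ 1 = P $ 1 / 2" "W $ 2 = P $ 2 / 2 - (P $ 1) ^ 2 / 4" by fact+
qed

section \<open>The function B and the transfer to power series\<close>

text \<open>The real part of 1 + z is positive, which avoids the branch cut. A zero of the
  denominator would force z = e - 1, which is outside the open disc since e \<ge> 2.\<close>

lemma B_denominator_nonzero:
  assumes "z \<in> \<D>" shows "1 + z \<notin> \<real>\<^sub>\<le>\<^sub>0" "1 - Ln (1 + z) \<noteq> 0"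
proof -
  have "Re (1 + z) > 0" using assms abs_Re_le_cmod[of z] by auto
  then show *: "1 + z \<notin> \<real>\<^sub>\<le>\<^sub>0" by (auto simp: complex_nonpos_Reals_iff)
  have "1 + z \<noteq> exp 1"
  proof
    assume "1 + z = exp 1"
    then have "z = exp 1 - 1" by (simp add: algebra_simps)
    then have "norm (exp 1 - 1 :: complex) < 1" using assms by simp
    moreover have "exp 1 - 1 = complex_of_real (exp 1 - 1)" by (simp add: exp_of_real[symmetric])
    ultimately have "\<bar>exp 1 - 1\<bar> < (1::real)" by (metis norm_of_real)
    then show False using exp_ge_add_one_self[of "1::real"] by simp
  qed
  moreover have "1 + z \<noteq> 0" using * by auto
  ultimately show "1 - Ln (1 + z) \<noteq> 0" using exp_Ln[of "1 + z"] by (metis right_minus_eq)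
qed

lemma B_fun_holomorphic: "B_fun holomorphic_on \<D>"
  unfolding B_fun_def[abs_def] by (intro holomorphic_intros) (use B_denominator_nonzero in auto)

text \<open>Stated for a given Schwarz function \<open>w\<close>, so that it serves both an
  arbitrary member of the class and the extremal function, where \<open>w\<close> is the
  identity.\<close>

lemma starlike_B_coeffs:
  assumes f: "f \<in> \<A>" "starlike_quotient f holomorphic_on \<D>"
    and w: "w holomorphic_on \<D>" "w ` \<D> \<subseteq> \<D>" "w 0 = 0"
    and sub: "\<forall>z\<in>\<D>. starlike_quotient f z = B_fun (w z)"
  defines "F \<equiv> fps_expansion f 0" and "W \<equiv> fps_expansion w 0"
    and "P \<equiv> fps_expansion (\<lambda>z. (1 + w z) / (1 - w z)) 0"
  shows "F $ 2 = P $ 1 / 2"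
    and "F $ 3 = P $ 2 / 4 + (P $ 1) ^ 2 / 16"
    and "F $ 4 = P $ 3 / 6 + P $ 1 * P $ 2 / 24 + (P $ 1) ^ 3 / 288"
    and "F $ 5 = P $ 4 / 8 + P $ 1 * P $ 3 / 48
      + (P $ 1) ^ 2 / 192 * (P $ 2 - (P $ 1) ^ 2 / 2) + 5 / 4608 * (P $ 1) ^ 4"
    and "W $ 1 = P $ 1 / 2" and "W $ 2 = P $ 2 / 2 - (P $ 1) ^ 2 / 4"
proof -
  let ?L = "\<lambda>z. Ln (1 + w z)" and ?p = "\<lambda>z. (1 + w z) / (1 - w z)"
  have wD: "w z \<in> \<D>" if "z \<in> \<D>" for z using w(2) that by blast
  have w1: "w z \<noteq> 1" if "z \<in> \<D>" for z using wD[OF that] by auto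
  have fhol: "f holomorphic_on \<D>" "f 0 = 0" "deriv f 0 = 1"
    using f(1) by (auto simp: normalized_analytic_def)
  have Lhol: "?L holomorphic_on \<D>"
    by (intro holomorphic_intros w) (use B_denominator_nonzero wD in auto)
  have phol: "?p holomorphic_on \<D>"
    by (intro holomorphic_intros w) (use w1 in auto)
  note E = holomorphic_disc_has_fps_expansion
  define Q where "Q = fps_expansion (starlike_quotient f) 0"
  define L where "L = fps_expansion ?L 0"
  have eF: "f has_fps_expansion F" and eW: "w has_fps_expansion W" and eP: "?p has_fps_expansion P"
    and eQ: "starlike_quotient f has_fps_expansion Q" and eL: "?L has_fps_expansion L"
    unfolding F_def W_def P_def Q_def L_def by (intro E fhol w phol f Lhol)+
  \<comment> \<open>The subordination with its denominator cleared; it also shows that the quotient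
    never vanishes on the disc.\<close>
  have id: "starlike_quotient f z * (1 - ?L z) = 1" if "z \<in> \<D>" for z
    using B_denominator_nonzero(2)[OF wD[OF that]] sub that by (simp add: B_fun_def)
  have 1: "fps_X * fps_deriv F = F * Q"
  proof (rule has_fps_expansion_disc_eq[of "\<lambda>z. z * deriv f z" _ "\<lambda>z. f z * starlike_quotient f z"])
    fix z assume z: "z \<in> \<D>"
    \<comment> \<open>A zero of \<open>f\<close> off the origin would make the quotient \<open>x / 0 = 0\<close>.\<close>
    have "starlike_quotient f z \<noteq> 0" using id[OF z] by auto
    then show "z * deriv f z = f z * starlike_quotient f z"
      using fhol(2) by (cases "z = 0") (auto simp: starlike_quotient_def)
  qed (intro fps_expansion_intros eF eQ)+
  have 2: "Q * (1 - L) = 1"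
    by (rule has_fps_expansion_disc_eq[of "\<lambda>z. starlike_quotient f z * (1 - ?L z)" _ "\<lambda>z. 1"])
      (intro fps_expansion_intros eQ eL id | assumption)+
  have 3: "fps_deriv L * (1 + W) = fps_deriv W"
  proof (rule has_fps_expansion_disc_eq[of "\<lambda>z. deriv ?L z * (1 + w z)" _ "deriv w"])
    fix z assume z: "z \<in> \<D>"
    have "(w has_field_derivative deriv w z) (at z)"
      using w(1) z by (intro holomorphic_derivI[of _ \<D>]) auto
    then have "(?L has_field_derivative deriv w z / (1 + w z)) (at z)"
      using B_denominator_nonzero(1)[OF wD[OF z]] by (auto intro!: derivative_eq_intros simp: divide_inverse)
    moreover have "1 + w z \<noteq> 0" using B_denominator_nonzero(1)[OF wD[OF z]] by auto
    ultimately show "deriv ?L z * (1 + w z) = deriv w z" by (simp add: DERIV_imp_deriv)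
  qed (intro fps_expansion_intros eL eW)+
  have 4: "P * (1 - W) = 1 + W"
    by (rule has_fps_expansion_disc_eq[of "\<lambda>z. ?p z * (1 - w z)" _ "\<lambda>z. 1 + w z"])
      (intro fps_expansion_intros eP eW | use w1 in simp)+
  have 0: "F $ 0 = 0" "F $ 1 = 1" "L $ 0 = 0" "W $ 0 = 0"
    using fhol w by (simp_all add: F_def L_def W_def fps_expansion_def)
  note C = fps_coeffs_starlike_B[OF 1 2 3 4 0]
  show "F $ 2 = P $ 1 / 2"
    and "F $ 3 = P $ 2 / 4 + (P $ 1) ^ 2 / 16"
    and "F $ 4 = P $ 3 / 6 + P $ 1 * P $ 2 / 24 + (P $ 1) ^ 3 / 288"
    and "F $ 5 = P $ 4 / 8 + P $ 1 * P $ 3 / 48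
      + (P $ 1) ^ 2 / 192 * (P $ 2 - (P $ 1) ^ 2 / 2) + 5 / 4608 * (P $ 1) ^ 4"
    and "W $ 1 = P $ 1 / 2" and "W $ 2 = P $ 2 / 2 - (P $ 1) ^ 2 / 4"
    by (fact C)+
qed

section \<open>The four upper bounds\<close>

lemma starlike_B_coeff_bounds:
  assumes "f \<in> \<S>\<^sub>B"
  shows "norm (taylor_coeff f 2) \<le> 1" "norm (taylor_coeff f 3) \<le> 3 / 4"
    "norm (taylor_coeff f 4) \<le> 19 / 36" "norm (taylor_coeff f 5) \<le> 101 / 288"
proof -
  obtain w where w: "w holomorphic_on \<D>" "w ` \<D> \<subseteq> \<D>" "w 0 = 0"
    and f: "f \<in> \<A>" "starlike_quotient f holomorphic_on \<D>"
    and sub: "\<forall>z\<in>\<D>. starlike_quotient f z = B_fun (w z)"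
    using assms by (auto simp: starlike_B_def subordinate_def)
  let ?p = "\<lambda>z. (1 + w z) / (1 - w z)"
  define P where "P = fps_expansion ?p 0"
  note C = starlike_B_coeffs[OF f w sub, folded P_def]
  have wD: "norm (w z) < 1" if "z \<in> \<D>" for z using w(2) that by (auto simp: image_subset_iff)
  have ne: "w z \<noteq> 1" if "z \<in> \<D>" for z using wD[OF that] by auto
  have pos: "Re (?p z) > 0" if "z \<in> \<D>" for z
  proof -
    \<comment> \<open>The real part of (1 + w) / (1 - w) is (1 - |w|^2) / |1 - w|^2.\<close>
    have "(Re (w z))\<^sup>2 + (Im (w z))\<^sup>2 < 1"
      using wD[OF that] by (simp add: cmod_def)
    moreover have "(1 - Re (w z))\<^sup>2 + (Im (w z))\<^sup>2 > 0"
      using ne[OF that] by (auto simp: sum_power2_gt_zero_iff complex_eq_iff)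
    ultimately show ?thesis
      by (simp add: Re_divide power2_eq_square algebra_simps divide_pos_pos)
  qed
  have P: "norm (P $ n) \<le> 2" if "n > 0" for n
    unfolding P_def
    by (rule caratheodory_coeff_bound) (use pos that w ne in \<open>auto intro!: holomorphic_intros\<close>)
  define y where "y = norm (P $ 1)"
  have y: "0 \<le> y" "y \<le> 2" using P[of 1] by (auto simp: y_def)
  \<comment> \<open>This is the bound for the second coefficient of \<open>w\<close>, rewritten
    through the formulas for \<open>W $ 1\<close> and \<open>W $ 2\<close> in terms of
    \<open>P\<close>.\<close>
  have "norm (P $ 2 / 2 - (P $ 1)\<^sup>2 / 4) \<le> 1 - (y / 2)\<^sup>2"
    using schwarz_second_coeff[OF w] unfolding C(5,6) by (simp add: norm_divide y_def)
  moreover have "P $ 2 - (P $ 1)\<^sup>2 / 2 = 2 * (P $ 2 / 2 - (P $ 1)\<^sup>2 / 4)"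
    by (simp add: field_simps)
  ultimately have P2: "norm (P $ 2 - (P $ 1)\<^sup>2 / 2) \<le> 2 - y\<^sup>2 / 2"
    by (simp only: norm_mult) (simp add: power_divide)
  show "norm (taylor_coeff f 2) \<le> 1"
    using y unfolding C(1) y_def by (simp add: norm_divide)
  show "norm (taylor_coeff f 3) \<le> 3 / 4"
  proof -
    have "norm (taylor_coeff f 3) \<le> norm (P $ 2 / 4) + norm ((P $ 1) ^ 2 / 16)"
      unfolding C(2) by (rule norm_triangle_ineq)
    also have "\<dots> \<le> 2 / 4 + 2\<^sup>2 / 16"
      unfolding norm_divide norm_power using P[of 2] P[of 1] power_mono[of "norm (P $ 1)" 2 2] by simp
    finally show ?thesis by simp
  qed
  show "norm (taylor_coeff f 4) \<le> 19 / 36"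
  proof -
    have "norm (taylor_coeff f 4) \<le> norm (P $ 3 / 6) + norm (P $ 1 * P $ 2 / 24) + norm ((P $ 1) ^ 3 / 288)"
      unfolding C(3) by (intro norm_triangle_mono order_refl)
    also have "\<dots> \<le> 2 / 6 + (2 * 2) / 24 + 2 ^ 3 / 288"
      unfolding norm_divide norm_power norm_mult
      by (intro add_mono divide_mono mult_mono power_mono P) auto
    finally show ?thesis by simp
  qed
  show "norm (taylor_coeff f 5) \<le> 101 / 288"
  proof -
    have "norm (taylor_coeff f 5) \<le> norm (P $ 4 / 8) + norm (P $ 1 * P $ 3 / 48)
        + norm ((P $ 1) ^ 2 / 192 * (P $ 2 - (P $ 1) ^ 2 / 2)) + norm (5 / 4608 * (P $ 1) ^ 4)"
      unfolding C(4) by (intro norm_triangle_mono order_refl)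
    \<comment> \<open>Here |p_1| is kept as \<open>y\<close>: the third term vanishes at y = 2, and
      bounding its two factors separately by their maxima would exceed 101/288.\<close>
    also have "\<dots> \<le> 2 / 8 + (y * 2) / 48 + y\<^sup>2 / 192 * (2 - y\<^sup>2 / 2) + 5 / 4608 * y ^ 4"
      unfolding norm_divide norm_power norm_mult y_def[symmetric]
      by (intro add_mono divide_mono mult_mono power_mono P P2 order_refl) (use y in auto)
    also have "\<dots> = (1 + y / 6 + y\<^sup>2 / 48 * (2 - y\<^sup>2 / 2) + 5 / 1152 * y ^ 4) / 4"
      by (simp add: field_simps)
    also have "\<dots> \<le> (101 / 72) / 4"
      by (intro divide_right_mono real_quartic_bound y) simp
    finally show ?thesis by simp
  qed
qed

section \<open>Sharpness\<close>

text \<open>The function z exp (\<integral> (B(t) - 1) / t dt), integrated from 0 to z, solves z f'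
  / f = B. Its Schwarz function is the identity, so this single function attains all four
  bounds.\<close>

lemma starlike_B_extremal:
  obtains f where "f \<in> \<S>\<^sub>B" "taylor_coeff f 2 = 1" "taylor_coeff f 3 = 3 / 4"
    "taylor_coeff f 4 = 19 / 36" "taylor_coeff f 5 = 101 / 288"
proof -
  have "(\<lambda>z. B_fun z - 1) holomorphic_on \<D>" "B_fun 0 - 1 = 0"
    by (intro holomorphic_intros B_fun_holomorphic) (simp add: B_fun_def)
  \<comment> \<open>\<open>h\<close> is (B(t) - 1) / t with its removable singularity at 0 filled
    in.\<close>
  then obtain h where h: "h holomorphic_on \<D>" "\<And>z. norm z < 1 \<Longrightarrow> B_fun z - 1 = z * h z"
    using Schwarz3 by blast
  obtain g where g: "\<And>z. z \<in> \<D> \<Longrightarrow> (g has_field_derivative h z) (at z)"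
    using holomorphic_convex_primitive'[OF _ _ h(1)] at_within_open[of _ "\<D>"] by (metis convex_ball open_ball)
  \<comment> \<open>Subtracting \<open>g 0\<close> makes the exponent vanish at the origin, which
    gives f'(0) = 1.\<close>
  define f where "f z = z * exp (g z - g 0)" for z
  have df: "(f has_field_derivative exp (g z - g 0) * (1 + z * h z)) (at z)" if "z \<in> \<D>" for z
    unfolding f_def[abs_def] using g[OF that]
    by (auto intro!: derivative_eq_intros simp: algebra_simps)
  have fA: "f \<in> \<A>"
    unfolding normalized_analytic_def
    using df DERIV_imp_deriv[OF df[of 0]] by (auto simp: f_def holomorphic_on_open) (use df in \<open>auto intro!: exI\<close>)
  have quot: "starlike_quotient f z = B_fun z" if "z \<in> \<D>" for z
  proof (cases "z = 0")
    case False
    then show ?thesis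
      using h(2)[of z] that DERIV_imp_deriv[OF df[OF that]]
      by (simp add: starlike_quotient_def f_def field_simps)
  qed (simp add: starlike_quotient_def B_fun_def)
  have hol: "starlike_quotient f holomorphic_on \<D>"
    using holomorphic_transform[OF B_fun_holomorphic] quot by metis
  have id: "(\<lambda>z::complex. z) holomorphic_on \<D>" "(\<lambda>z::complex. z) ` \<D> \<subseteq> \<D>" "(\<lambda>z::complex. z) 0 = 0"
    by auto
  define P where "P = fps_expansion (\<lambda>z::complex. (1 + z) / (1 - z)) 0"
  have C: "taylor_coeff f 2 = P $ 1 / 2"
    "taylor_coeff f 3 = P $ 2 / 4 + (P $ 1) ^ 2 / 16"
    "taylor_coeff f 4 = P $ 3 / 6 + P $ 1 * P $ 2 / 24 + (P $ 1) ^ 3 / 288"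
    "taylor_coeff f 5 = P $ 4 / 8 + P $ 1 * P $ 3 / 48
      + (P $ 1) ^ 2 / 192 * (P $ 2 - (P $ 1) ^ 2 / 2) + 5 / 4608 * (P $ 1) ^ 4"
    unfolding P_def using starlike_B_coeffs[OF fA hol id ballI[OF quot]] by simp_all
  \<comment> \<open>Comparing coefficients gives p_0 = 1, p_1 = p_0 + 1 and p_n = p_(n-1) from n = 2
    on, hence the value 2 throughout.\<close>
  have "P * (1 - fps_X) = 1 + fps_X"
  proof (rule has_fps_expansion_disc_eq)
    show "(\<lambda>z. (1 + z) / (1 - z) * (1 - z)) has_fps_expansion P * (1 - fps_X)"
      unfolding P_def
      by (intro fps_expansion_intros holomorphic_disc_has_fps_expansion holomorphic_intros) auto
    show "(\<lambda>z::complex. 1 + z) has_fps_expansion 1 + fps_X"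
      by (intro fps_expansion_intros)
  qed auto
  note e = arg_cong[OF this, of "\<lambda>F. fps_nth F n" for n]
  have "P $ 0 = 1" "P $ 1 = 2" "P $ 2 = 2" "P $ 3 = 2" "P $ 4 = 2"
    using e[of 0] e[of 1] e[of 2] e[of 3] e[of 4] by (simp_all add: fps_mult_nth_small fps_X_def)
  then have "taylor_coeff f 2 = 1" "taylor_coeff f 3 = 3 / 4"
    "taylor_coeff f 4 = 19 / 36" "taylor_coeff f 5 = 101 / 288"
    unfolding C by simp_all
  moreover have "f \<in> \<S>\<^sub>B"
    unfolding starlike_B_def subordinate_def using fA hol B_fun_holomorphic id quot by blast
  ultimately show ?thesis using that by blast
qed

theorem theorem3p1:
  shows "(\<forall>f\<in>\<S>\<^sub>B.
            norm (taylor_coeff f 2) \<le> 1 \<and>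
            norm (taylor_coeff f 3) \<le> 3 / 4 \<and>
            norm (taylor_coeff f 4) \<le> 19 / 36 \<and>
            norm (taylor_coeff f 5) \<le> 101 / 288) \<and>
         (\<exists>f\<in>\<S>\<^sub>B. norm (taylor_coeff f 2) = 1) \<and>
         (\<exists>f\<in>\<S>\<^sub>B. norm (taylor_coeff f 3) = 3 / 4) \<and>
         (\<exists>f\<in>\<S>\<^sub>B. norm (taylor_coeff f 4) = 19 / 36) \<and>
         (\<exists>f\<in>\<S>\<^sub>B. norm (taylor_coeff f 5) = 101 / 288)"
proof -
  obtain f where f: "f \<in> \<S>\<^sub>B" and c: "taylor_coeff f 2 = 1" "taylor_coeff f 3 = 3 / 4"
    "taylor_coeff f 4 = 19 / 36" "taylor_coeff f 5 = 101 / 288"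
    by (rule starlike_B_extremal)
  have "norm (taylor_coeff f 2) = 1" "norm (taylor_coeff f 3) = 3 / 4"
    "norm (taylor_coeff f 4) = 19 / 36" "norm (taylor_coeff f 5) = 101 / 288"
    unfolding c by (simp_all add: norm_divide)
  then show ?thesis using f starlike_B_coeff_bounds by blast
qed

end
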